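(* Let $H$ be a 3-uniform hypergraph. Then $H$ is realizable if and only if for every $W\subseteq V(H)$ such that $H[W]$ is prime, $H[W]$ is realizable.
   Context: All structures are finite. A 3-uniform hypergraph $H$ consists of a vertex set $V(H)$ and an edge set $E(H)\subseteq\binom{V(H)}{3}$. For $W\subseteq V(H)$, $H[W]$ is the hypergraph with vertex set $W$ and edge set $\{e\in E(H):e\subseteq W\}$. A 3-cycle is a tournament on three vertices isomorphic to $(\{0,1,2\},\{01,12,20\})$. The $C_3$-structure $C_3(T)$ of a tournament $T$ is the 3-uniform hypergraph on $V(T)$ whose edges are the 3-element subsets $X$ of $V(T)$ such that $T[X]$ is a 3-cycle. A tournament $T$ with $V(T)=V(H)$ is a realization of $H$ if $H=C_3(T)$; $H$ is realizable if it admits a realization. A subset $M$ of $V(H)$ is a module of $H$ if for each $e\in E(H)$ such that $e\cap M\neq\emptyset$ and $e\setminus M\neq\emptyset$, there exists $m\in M$ such that $e\cap M=\{m\}$ and for every $n\in M$, $(e\setminus\{m\})\cup\{n\}\in E(H)$. The sets $\emptyset$, $V(H)$ and $\{v\}$ ($v\in V(H)$) are modules, called trivial. $H$ is prime if $|V(H)|\geq 3$ and all its modules are trivial. *)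

theory Defs
  imports "Graph_Theory.Graph_Theory"
begin

record 'a hypergraph =
  hverts :: "'a set"
  hedges :: "'a set set"

locale hypergraph3 =
  fixes H :: "'a hypergraph"
  assumes finite_hverts: "finite (hverts H)"
    and hedges_subset: "e \<in> hedges H \<Longrightarrow> e \<subseteq> hverts H"
    and hedges_card: "e \<in> hedges H \<Longrightarrow> card e = 3"

definition induced_hypergraph :: "'a hypergraph \<Rightarrow> 'a set \<Rightarrow> 'a hypergraph" where
  "induced_hypergraph H W = \<lparr> hverts = W, hedges = {e \<in> hedges H. e \<subseteq> W} \<rparr>"

(* pair_digraph already provides: finite, loop-free, arcs between vertices. *)
locale tournament = pair_digraph T for T :: "'a pair_pre_digraph" +
  assumes exactly_one_arc:
    "\<lbrakk> u \<in> pverts T; v \<in> pverts T; u \<noteq> v \<rbrakk> \<Longrightarrow> (u, v) \<in> parcs T \<longleftrightarrow> (v, u) \<notin> parcs T"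

definition cycle3 :: "nat pair_pre_digraph" where
  "cycle3 = \<lparr> pverts = {0, 1, 2}, parcs = {(0, 1), (1, 2), (2, 0)} \<rparr>"

definition C3_structure :: "'a pair_pre_digraph \<Rightarrow> 'a hypergraph" where
  "C3_structure T = \<lparr> hverts = pverts T,
     hedges = {X. X \<subseteq> pverts T \<and> card X = 3
                  \<and> digraph_iso (with_proj T \<restriction> X) (with_proj cycle3)} \<rparr>"

definition realization :: "'a pair_pre_digraph \<Rightarrow> 'a hypergraph \<Rightarrow> bool" where
  "realization T H \<longleftrightarrow> tournament T \<and> pverts T = hverts H \<and> H = C3_structure T"

definition realizable :: "'a hypergraph \<Rightarrow> bool" where
  "realizable H \<longleftrightarrow> (\<exists>T. realization T H)"

definition hmodule :: "'a hypergraph \<Rightarrow> 'a set \<Rightarrow> bool" where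
  "hmodule H M \<longleftrightarrow> M \<subseteq> hverts H \<and>
     (\<forall>e \<in> hedges H. e \<inter> M \<noteq> {} \<and> e - M \<noteq> {} \<longrightarrow>
       (\<exists>m \<in> M. e \<inter> M = {m} \<and> (\<forall>n \<in> M. (e - {m}) \<union> {n} \<in> hedges H)))"

definition trivial_module :: "'a hypergraph \<Rightarrow> 'a set \<Rightarrow> bool" where
  "trivial_module H M \<longleftrightarrow> M = {} \<or> M = hverts H \<or> (\<exists>v \<in> hverts H. M = {v})"

definition hprime :: "'a hypergraph \<Rightarrow> bool" where
  "hprime H \<longleftrightarrow> card (hverts H) \<ge> 3 \<and> (\<forall>M. hmodule H M \<longrightarrow> trivial_module H M)"

end

theory Submission
  imports Defs
begin

text \<open>
  The converse is by induction on the number of vertices. If \<open>M\<close> is a nontrivial module and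
  \<open>m \<in> M\<close>, realizations of \<open>H[M]\<close> and \<open>H[(V - M) \<union> {m}]\<close> combine by substituting the former for
  \<open>m\<close> in the latter. No 3-cycle of the result meets \<open>M\<close> in exactly two vertices, since a vertex
  outside \<open>M\<close> dominates all of \<open>M\<close> or is dominated by all of \<open>M\<close>; the definition of a module says
  exactly that no edge of \<open>H\<close> does so either and that edges with a single vertex in \<open>M\<close> may be read
  off at \<open>m\<close>.
\<close>

section \<open>3-cycles as triples of arcs\<close>

text \<open>An elementary stand-in for the digraph isomorphism with \<open>cycle3\<close>.
  Distinctness of the three vertices is not built in; it follows from looplessness of a
  tournament.\<close>

definition cyclic_triple :: "'a rel \<Rightarrow> 'a set \<Rightarrow> bool" where
  "cyclic_triple A X \<longleftrightarrow> (\<exists>x y z. X = {x, y, z} \<and> (x, y) \<in> A \<and> (y, z) \<in> A \<and> (z, x) \<in> A)"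

lemma cyclic_triple_subset: "cyclic_triple A X \<Longrightarrow> A \<subseteq> V \<times> V \<Longrightarrow> X \<subseteq> V"
  unfolding cyclic_triple_def by blast

lemma cyclic_triple_Int_Times: "cyclic_triple (A \<inter> V \<times> V) X \<longleftrightarrow> cyclic_triple A X \<and> X \<subseteq> V"
  unfolding cyclic_triple_def by blast

text \<open>The three arcs of \<open>cycle3\<close> are lifted through the isomorphism, and
  injectivity on vertices glues the lifted arcs at their endpoints.\<close>

lemma digraph_iso_cycle3_imp_cyclic:
  assumes "digraph_iso (with_proj T \<restriction> X) (with_proj cycle3)"
  shows "cyclic_triple (parcs T) X"
proof -
  obtain f where iso: "pre_digraph.digraph_isomorphism (with_proj T \<restriction> X) f"
    and eq: "with_proj cycle3 = app_iso f (with_proj T \<restriction> X)"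
    using assms unfolding digraph_iso_def by blast
  let ?g = "iso_verts f"
  have inj: "inj_on ?g X"
    using iso by (simp add: pre_digraph.digraph_isomorphism_def)
  have img: "?g ` X = {0, 1, 2}"
    using arg_cong[OF eq, of verts] by (simp add: cycle3_def)
  have arcs: "iso_arcs f ` {e \<in> parcs T. fst e \<in> X \<and> snd e \<in> X} = {(0, 1), (1, 2), (2, 0)}"
    using arg_cong[OF eq, of arcs] by (simp add: cycle3_def)
  \<comment> \<open>The tail and head maps of \<open>app_iso f G\<close> are those stored in
    \<open>f\<close>, so equality with \<open>with_proj cycle3\<close> forces them to be the
    projections.\<close>
  have ends: "iso_tail f = fst" "iso_head f = snd"
    using arg_cong[OF eq, of tail] arg_cong[OF eq, of head] by simp_all
  have lift: "\<exists>u\<in>X. \<exists>v\<in>X. (u, v) \<in> parcs T \<and> ?g u = i \<and> ?g v = j"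
    if ij: "(i, j) \<in> {(0, 1), (1, 2), (2, 0)}" for i j
  proof -
    obtain e where "e \<in> parcs T" "fst e \<in> X" "snd e \<in> X" "iso_arcs f e = (i, j)"
      using ij unfolding arcs[symmetric] by auto
    moreover from this have "?g (fst e) = i" "?g (snd e) = j"
      using iso ends by (force simp: pre_digraph.digraph_isomorphism_def)+
    ultimately show ?thesis by (metis prod.collapse)
  qed
  obtain x y where xy: "x \<in> X" "y \<in> X" "(x, y) \<in> parcs T" "?g x = 0" "?g y = 1"
    using lift[of 0 1] by auto
  obtain y' z where yz: "y' \<in> X" "z \<in> X" "(y', z) \<in> parcs T" "?g y' = 1" "?g z = 2"
    using lift[of 1 2] by auto
  obtain z' x' where zx: "z' \<in> X" "x' \<in> X" "(z', x') \<in> parcs T" "?g z' = 2" "?g x' = 0"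
    using lift[of 2 0] by auto
  \<comment> \<open>The arcs were lifted independently, so the shared endpoints still have to be
    identified.\<close>
  have same: "y' = y" "z' = z" "x' = x"
    using xy yz zx by (auto intro!: inj_onD[OF inj])
  have "?g ` X = ?g ` {x, y, z}"
    using img xy yz by simp
  then have "X = {x, y, z}"
    using inj xy yz by (intro iffD1[OF inj_on_image_eq_iff[OF inj]]) auto
  then show ?thesis
    using xy yz zx same unfolding cyclic_triple_def by blast
qed

context tournament
begin

lemma arc_antisym: "(u, v) \<in> parcs T \<Longrightarrow> (v, u) \<notin> parcs T"
  using exactly_one_arc[of u v] in_arcsD1 in_arcsD2 no_loops' by blast

lemma arc_neq: "(u, v) \<in> parcs T \<Longrightarrow> u \<noteq> v"
  using no_loops' .

lemma arcs_Times: "parcs T \<subseteq> pverts T \<times> pverts T"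
  using in_arcsD1 in_arcsD2 by auto

lemma cyclic_triple_card: "cyclic_triple (parcs T) X \<Longrightarrow> card X = 3"
  unfolding cyclic_triple_def using arc_neq by (force simp: card_insert_if)

lemma cyclic_triple_imp_digraph_iso:
  assumes "cyclic_triple (parcs T) X"
  shows "digraph_iso (with_proj T \<restriction> X) (with_proj cycle3)"
proof -
  obtain x y z where X: "X = {x, y, z}"
    and A: "(x, y) \<in> parcs T" "(y, z) \<in> parcs T" "(z, x) \<in> parcs T"
    using assms unfolding cyclic_triple_def by blast
  have neq: "x \<noteq> y" "y \<noteq> z" "z \<noteq> x"
    using A arc_neq by auto
  have arcs: "{e \<in> parcs T. fst e \<in> X \<and> snd e \<in> X} = {(x, y), (y, z), (z, x)}"
    using A A[THEN arc_antisym] X arc_neq[of x x] arc_neq[of y y] arc_neq[of z z] by auto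
  \<comment> \<open>The vertices are numbered along the cycle; on \<open>X\<close> the final value 2
    is taken only at \<open>z\<close>.\<close>
  let ?g = "\<lambda>v. if v = x then 0 else if v = y then 1 else (2::nat)"
  let ?f = "\<lparr>iso_verts = ?g, iso_arcs = map_prod ?g ?g, iso_head = snd, iso_tail = fst\<rparr>"
  have wf: "wf_digraph (with_proj T \<restriction> X)"
    by unfold_locales auto
  have "pre_digraph.digraph_isomorphism (with_proj T \<restriction> X) ?f"
    unfolding pre_digraph.digraph_isomorphism_def
    using wf neq by (simp add: arcs) (auto simp: X inj_on_def)
  moreover have "with_proj cycle3 = app_iso ?f (with_proj T \<restriction> X)"
    using neq by (simp add: arcs app_iso_def) (auto simp: X cycle3_def with_proj_def)
  ultimately show ?thesis
    unfolding digraph_iso_def by blast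
qed

lemma hedges_C3_structure: "hedges (C3_structure T) = {X. cyclic_triple (parcs T) X}"
  unfolding C3_structure_def
  using digraph_iso_cycle3_imp_cyclic cyclic_triple_imp_digraph_iso cyclic_triple_card
    cyclic_triple_subset[OF _ arcs_Times]
  by fastforce

end

text \<open>Realizations become a pointwise test on edges, so the later arguments never mention
  digraph isomorphisms.\<close>

lemma realization_iff:
  "realization T H \<longleftrightarrow> tournament T \<and> pverts T = hverts H \<and>
     (\<forall>X. X \<in> hedges H \<longleftrightarrow> cyclic_triple (parcs T) X)"
proof -
  have "H = C3_structure T \<longleftrightarrow> hverts H = pverts T \<and> hedges H = hedges (C3_structure T)"
    by (cases H) (auto simp: C3_structure_def)
  then have "tournament T \<Longrightarrow> H = C3_structure T \<longleftrightarrow>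
      hverts H = pverts T \<and> hedges H = {X. cyclic_triple (parcs T) X}"
    by (simp add: tournament.hedges_C3_structure)
  then show ?thesis
    unfolding realization_def by blast
qed

lemma tournamentI:
  assumes "finite (pverts T)" "parcs T \<subseteq> pverts T \<times> pverts T"
    and "\<And>u. (u, u) \<notin> parcs T"
    and "\<And>u v. u \<in> pverts T \<Longrightarrow> v \<in> pverts T \<Longrightarrow> u \<noteq> v \<Longrightarrow>
           (u, v) \<in> parcs T \<longleftrightarrow> (v, u) \<notin> parcs T"
  shows "tournament T"
proof unfold_locales
  show "finite (parcs T)"
    using assms(1,2) finite_subset by blast
  show "(u, v) \<in> parcs T \<longleftrightarrow> (v, u) \<notin> parcs T"
    if "u \<in> pverts T" "v \<in> pverts T" "u \<noteq> v" for u v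
    using assms(4) that .
qed (use assms(1-3) in auto)

section \<open>Induced hypergraphs and small cases\<close>

text \<open>Whether three vertices of \<open>W\<close> form a 3-cycle depends only on the arcs
  inside \<open>W\<close>, so restricting a realization suffices.\<close>

lemma realizable_induced:
  assumes "realizable H" "W \<subseteq> hverts H"
  shows "realizable (induced_hypergraph H W)"
proof -
  obtain T where T: "tournament T" "pverts T = hverts H"
    and E: "\<And>X. X \<in> hedges H \<longleftrightarrow> cyclic_triple (parcs T) X"
    using assms(1) unfolding realizable_def realization_iff by blast
  interpret tournament T by fact
  let ?T = "\<lparr>pverts = W, parcs = parcs T \<inter> W \<times> W\<rparr>"
  have "finite W"
    using assms(2) T(2) pair_finite_verts finite_subset by metis
  have "tournament ?T"
  proof (rule tournamentI; simp)
    show "finite W" by fact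
    show "(u, u) \<in> parcs T \<longrightarrow> u \<notin> W" for u
      using arc_neq by blast
    show "(u, v) \<in> parcs T \<longleftrightarrow> (v, u) \<notin> parcs T" if "u \<in> W" "v \<in> W" "u \<noteq> v" for u v
      using that assms(2) T(2) exactly_one_arc by blast
  qed
  then have "realization ?T (induced_hypergraph H W)"
    unfolding realization_iff
    by (simp add: induced_hypergraph_def E cyclic_triple_Int_Times)
  then show ?thesis
    unfolding realizable_def by blast
qed

lemma induced_induced:
  "W \<subseteq> U \<Longrightarrow> induced_hypergraph (induced_hypergraph H U) W = induced_hypergraph H W"
  by (auto simp: induced_hypergraph_def)

lemma induced_hverts: "hypergraph3 H \<Longrightarrow> induced_hypergraph H (hverts H) = H"
  by (auto simp: induced_hypergraph_def hypergraph3_def intro!: hypergraph.equality)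

lemma hypergraph3_induced:
  "hypergraph3 H \<Longrightarrow> W \<subseteq> hverts H \<Longrightarrow> hypergraph3 (induced_hypergraph H W)"
  by (auto simp: induced_hypergraph_def hypergraph3_def intro: finite_subset)

text \<open>There is no room for an edge, and a transitive tournament, here ordered by an injection
  into the naturals, has no 3-cycle.\<close>

lemma (in hypergraph3) realizable_if_small:
  assumes "card (hverts H) < 3"
  shows "realizable H"
proof -
  obtain f :: "'a \<Rightarrow> nat" where f: "inj_on f (hverts H)"
    using finite_imp_inj_to_nat_seg[OF finite_hverts] by blast
  let ?T = "\<lparr>pverts = hverts H, parcs = {(u, v) \<in> hverts H \<times> hverts H. f u < f v}\<rparr>"
  have "tournament ?T"
    using finite_hverts f
    by (intro tournamentI) (auto dest: inj_onD intro: linorder_neqE_nat)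
  moreover have "X \<notin> hedges H" for X
    using hedges_card[of X] hedges_subset[of X] card_mono[OF finite_hverts, of X] assms by auto
  moreover have "\<not> cyclic_triple (parcs ?T) X" for X
    by (auto simp: cyclic_triple_def)
  ultimately have "realization ?T H"
    unfolding realization_iff by simp
  then show ?thesis
    unfolding realizable_def by blast
qed

section \<open>Modules and substitution\<close>

text \<open>The map \<open>r\<close> collapses \<open>M\<close> to \<open>m\<close>. Injectivity of
  \<open>r\<close> on \<open>X\<close> says that \<open>X\<close> meets \<open>M\<close> in at most
  one vertex, which the module condition forces for an edge not inside \<open>M\<close>.\<close>

lemma hmodule_edge_iff:
  assumes M: "hmodule H M" "m \<in> M" and X: "X \<subseteq> hverts H" "\<not> X \<subseteq> M"
  defines "r \<equiv> \<lambda>u. if u \<in> M then m else u"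
  shows "X \<in> hedges H \<longleftrightarrow> inj_on r X \<and> r ` X \<in> hedges H"
proof (cases "X \<inter> M = {}")
  case True
  then have "r ` X = X" "inj_on r X"
    by (auto simp: r_def inj_on_def image_iff)
  then show ?thesis by simp
next
  case False
  \<comment> \<open>The module condition provides some vertex of \<open>M\<close>, which must be
    \<open>k\<close>; that vertex may be exchanged for any other vertex of \<open>M\<close>.\<close>
  have swap: "(e - {k}) \<union> {n} \<in> hedges H"
    if e: "e \<in> hedges H" "e \<inter> M = {k}" "\<not> e \<subseteq> M" "n \<in> M" for e k n
  proof -
    have "e \<inter> M \<noteq> {} \<and> e - M \<noteq> {}"
      using e by auto
    then obtain m' where "e \<inter> M = {m'}" "\<forall>n\<in>M. (e - {m'}) \<union> {n} \<in> hedges H"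
      using M(1) e(1) unfolding hmodule_def by meson
    moreover from this have "m' = k"
      using e(2) by simp
    ultimately show ?thesis
      using e(4) by blast
  qed
  have single: "inj_on r X \<and> r ` X = (X - {k}) \<union> {m}" if "X \<inter> M = {k}" for k
  proof -
    have "x = k" if "x \<in> X" "x \<in> M" for x
      using that \<open>X \<inter> M = {k}\<close> by blast
    then show ?thesis
      using that M(2) by (auto simp: r_def inj_on_def)
  qed
  show ?thesis
  proof
    assume e: "X \<in> hedges H"
    moreover have "X - M \<noteq> {}"
      using X(2) by auto
    ultimately obtain k where "X \<inter> M = {k}"
      using M(1) False unfolding hmodule_def by meson
    then show "inj_on r X \<and> r ` X \<in> hedges H"
      using single swap[OF e _ X(2) M(2)] by simp
  next
    assume r: "inj_on r X \<and> r ` X \<in> hedges H"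
    obtain k where k: "k \<in> X" "k \<in> M"
      using False by blast
    then have k': "X \<inter> M = {k}"
      using r by (auto simp: r_def inj_on_def)
    have eq: "r ` X = (X - {k}) \<union> {m}"
      using single[OF k'] by blast
    have "((X - {k}) \<union> {m}) \<inter> M = {m}" "\<not> (X - {k}) \<union> {m} \<subseteq> M"
      using k' X(2) M(2) by auto
    \<comment> \<open>The exchange is undone: \<open>m\<close> is replaced by \<open>k\<close> in
      the collapsed edge.\<close>
    then have "((X - {k}) \<union> {m}) - {m} \<union> {k} \<in> hedges H"
      using swap[of "(X - {k}) \<union> {m}" m k] r eq k by auto
    moreover have "((X - {k}) \<union> {m}) - {m} \<union> {k} = X"
      using k k' M(2) by auto
    ultimately show "X \<in> hedges H" by simp
  qed
qed

text \<open>A pulled-back cycle maps to three distinct vertices because arcs are not loops.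
  Conversely, injectivity excludes larger sets \<open>X\<close> whose image is a cyclic
  triple.\<close>

lemma (in tournament) cyclic_triple_pullback_iff:
  assumes r: "\<And>u. u \<in> X \<Longrightarrow> u \<in> V"
  shows "cyclic_triple {(u, v) \<in> V \<times> V. (r u, r v) \<in> parcs T} X \<longleftrightarrow>
    inj_on r X \<and> cyclic_triple (parcs T) (r ` X)"
proof
  assume "cyclic_triple {(u, v) \<in> V \<times> V. (r u, r v) \<in> parcs T} X"
  then obtain x y z where "X = {x, y, z}"
    "(r x, r y) \<in> parcs T" "(r y, r z) \<in> parcs T" "(r z, r x) \<in> parcs T"
    unfolding cyclic_triple_def by blast
  then show "inj_on r X \<and> cyclic_triple (parcs T) (r ` X)"
    using arc_neq unfolding cyclic_triple_def inj_on_def by fastforce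
next
  assume A: "inj_on r X \<and> cyclic_triple (parcs T) (r ` X)"
  then obtain x y z where X: "r ` X = {x, y, z}"
    and arcs: "(x, y) \<in> parcs T" "(y, z) \<in> parcs T" "(z, x) \<in> parcs T"
    unfolding cyclic_triple_def by blast
  obtain a b c where abc: "a \<in> X" "b \<in> X" "c \<in> X" "r a = x" "r b = y" "r c = z"
    using X by (metis imageE insertI1 insertI2)
  have "r ` X = r ` {a, b, c}"
    using X abc by simp
  then have "X = {a, b, c}"
    using A abc inj_on_image_eq_iff[of r X X "{a, b, c}"] by auto
  then show "cyclic_triple {(u, v) \<in> V \<times> V. (r u, r v) \<in> parcs T} X"
    using arcs abc r unfolding cyclic_triple_def by blast
qed

lemma (in hypergraph3) realizable_if_module:
  assumes M: "hmodule H M" "m \<in> M"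
    and R1: "realizable (induced_hypergraph H M)"
    and R2: "realizable (induced_hypergraph H ((hverts H - M) \<union> {m}))"
  shows "realizable H"
proof -
  let ?V = "hverts H" and ?W = "(hverts H - M) \<union> {m}"
  have MV: "M \<subseteq> ?V"
    using M(1) by (simp add: hmodule_def)
  obtain T1 where T1: "tournament T1" "pverts T1 = M"
    and E1: "\<And>X. X \<in> hedges H \<and> X \<subseteq> M \<longleftrightarrow> cyclic_triple (parcs T1) X"
    using R1 unfolding realizable_def realization_iff by (auto simp: induced_hypergraph_def)
  obtain T2 where T2: "tournament T2" "pverts T2 = ?W"
    and E2: "\<And>X. X \<in> hedges H \<and> X \<subseteq> ?W \<longleftrightarrow> cyclic_triple (parcs T2) X"
    using R2 unfolding realizable_def realization_iff by (auto simp: induced_hypergraph_def)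
  interpret T1: tournament T1 by fact
  interpret T2: tournament T2 by fact
  \<comment> \<open>\<open>B\<close> pulls \<open>T2\<close> back along the collapse of
    \<open>M\<close> to \<open>m\<close>. It has no arc inside \<open>M\<close>, since
    \<open>T2\<close> has no loop at \<open>m\<close>; the arcs of \<open>T1\<close> fill this gap
    in \<open>A\<close>.\<close>
  define r where "r = (\<lambda>u. if u \<in> M then m else u)"
  define B where "B = {(u, v) \<in> ?V \<times> ?V. (r u, r v) \<in> parcs T2}"
  define A where "A = parcs T1 \<union> B"
  have A_M: "A \<inter> M \<times> M = parcs T1"
    using T1.arcs_Times T1(2) T2.arc_neq[of m m] by (auto simp: A_def B_def r_def)
  have A_notM: "(u, v) \<in> A \<longleftrightarrow> (u, v) \<in> B" if "u \<notin> M \<or> v \<notin> M" for u v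
    using that T1.arcs_Times T1(2) by (auto simp: A_def)
  have A_in_M: "(u, v) \<in> A \<longleftrightarrow> (u, v) \<in> parcs T1" if "u \<in> M" "v \<in> M" for u v
    using that A_M by blast
  have rW: "r u \<in> ?W" if "u \<in> ?V" for u
    using that by (simp add: r_def)
  have "tournament \<lparr>pverts = ?V, parcs = A\<rparr>"
  proof (rule tournamentI; simp)
    show "finite ?V" by (rule finite_hverts)
    show "A \<subseteq> ?V \<times> ?V"
      using T1.arcs_Times T1(2) MV by (auto simp: A_def B_def)
    show "(u, u) \<notin> A" for u
      using T1.arc_neq T2.arc_neq by (auto simp: A_def B_def)
    show "(u, v) \<in> A \<longleftrightarrow> (v, u) \<notin> A" if uv: "u \<in> ?V" "v \<in> ?V" "u \<noteq> v" for u v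
    proof (cases "u \<in> M \<and> v \<in> M")
      case True
      then show ?thesis
        using A_in_M[of u v] A_in_M[of v u] T1.exactly_one_arc[of u v] T1(2) uv by simp
    next
      case False
      then have "r u \<noteq> r v"
        using uv M(2) by (auto simp: r_def)
      then show ?thesis
        using False A_notM[of u v] A_notM[of v u] T2.exactly_one_arc[of "r u" "r v"]
          T2(2) rW[OF uv(1)] rW[OF uv(2)] uv by (auto simp: B_def)
    qed
  qed
  moreover have "X \<in> hedges H \<longleftrightarrow> cyclic_triple A X" for X
  proof (cases "X \<subseteq> M")
    case True
    then show ?thesis
      using E1[of X] cyclic_triple_Int_Times[of A M X] A_M by simp
  next
    case False
    have "cyclic_triple A X \<longleftrightarrow> cyclic_triple B X"
    proof
      assume "cyclic_triple A X"
      then obtain x y z where X: "X = {x, y, z}"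
        and arcs: "(x, y) \<in> A" "(y, z) \<in> A" "(z, x) \<in> A"
        unfolding cyclic_triple_def by blast
      \<comment> \<open>A cycle with exactly two vertices in \<open>M\<close> would yield arcs of
        \<open>T2\<close> in both directions between \<open>m\<close> and the outer vertex.\<close>
      have no_two: False
        if "a \<in> M" "b \<in> M" "c \<notin> M" "(b, c) \<in> A" "(c, a) \<in> A" for a b c
      proof -
        have "(m, c) \<in> parcs T2" "(c, m) \<in> parcs T2"
          using that A_notM[of b c] A_notM[of c a] by (auto simp: B_def r_def)
        then show False
          using T2.arc_antisym by blast
      qed
      \<comment> \<open>The three rotations of the cycle show that each of its arcs has an end
        outside \<open>M\<close>, hence lies in \<open>B\<close>.\<close>
      have "\<not> (x \<in> M \<and> y \<in> M)" "\<not> (y \<in> M \<and> z \<in> M)" "\<not> (z \<in> M \<and> x \<in> M)"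
        using no_two[of x y z] no_two[of y z x] no_two[of z x y] arcs False X by auto
      then show "cyclic_triple B X"
        using arcs A_notM X unfolding cyclic_triple_def by blast
    qed (auto simp: cyclic_triple_def A_def)
    moreover have "X \<in> hedges H \<longleftrightarrow> cyclic_triple B X" if "X \<subseteq> ?V"
    proof -
      have "r ` X \<subseteq> ?W"
        using that rW by blast
      moreover have "X \<in> hedges H \<longleftrightarrow> inj_on r X \<and> r ` X \<in> hedges H"
        using hmodule_edge_iff[OF M that False] unfolding r_def .
      moreover have "cyclic_triple B X \<longleftrightarrow> inj_on r X \<and> cyclic_triple (parcs T2) (r ` X)"
        using that unfolding B_def by (intro T2.cyclic_triple_pullback_iff) auto
      ultimately show ?thesis
        using E2[of "r ` X"] by simp
    qed
    moreover have "X \<subseteq> ?V" if "X \<in> hedges H \<or> cyclic_triple B X"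
      using that hedges_subset cyclic_triple_subset[of B X ?V] by (auto simp: B_def)
    ultimately show ?thesis by blast
  qed
  ultimately have "realization \<lparr>pverts = ?V, parcs = A\<rparr> H"
    unfolding realization_iff by simp
  then show ?thesis
    unfolding realizable_def by blast
qed

section \<open>Induction on the number of vertices\<close>

lemma realizable_if_primes_realizable:
  assumes "hypergraph3 H"
    and "\<And>W. W \<subseteq> hverts H \<Longrightarrow> hprime (induced_hypergraph H W) \<Longrightarrow>
           realizable (induced_hypergraph H W)"
  shows "realizable H"
  using assms
proof (induction "card (hverts H)" arbitrary: H rule: less_induct)
  case less
  interpret hypergraph3 H by fact
  \<comment> \<open>The hypothesis on prime induced hypergraphs passes to \<open>H[U]\<close>,
    because inducing twice amounts to inducing once.\<close>
  have smaller: "realizable (induced_hypergraph H U)" if "U \<subset> hverts H" for U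
  proof (rule less.hyps)
    show "card (hverts (induced_hypergraph H U)) < card (hverts H)"
      using psubset_card_mono[OF finite_hverts that] by (simp add: induced_hypergraph_def)
    show "hypergraph3 (induced_hypergraph H U)"
      using hypergraph3_induced[OF less.prems(1)] that by blast
    fix W
    assume W: "W \<subseteq> hverts (induced_hypergraph H U)"
      "hprime (induced_hypergraph (induced_hypergraph H U) W)"
    then have "W \<subseteq> U"
      by (simp add: induced_hypergraph_def)
    then show "realizable (induced_hypergraph (induced_hypergraph H U) W)"
      using W(2) less.prems(2)[of W] that by (auto simp: induced_induced)
  qed
  consider "card (hverts H) < 3" | "hprime H"
    | M where "hmodule H M" "\<not> trivial_module H M"
    unfolding hprime_def by force
  then show ?case
  proof cases
    case 1
    then show ?thesis by (rule realizable_if_small)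
  next
    case 2
    then show ?thesis
      using less.prems(2)[of "hverts H"] induced_hverts[OF less.prems(1)] by simp
  next
    case 3
    then obtain m where m: "m \<in> M"
      unfolding trivial_module_def by blast
    have MV: "M \<subset> hverts H"
      using 3 unfolding trivial_module_def hmodule_def by blast
    \<comment> \<open>A nontrivial module is not a singleton; the second vertex \<open>n\<close> is
      missing from the quotient vertex set, which is therefore proper.\<close>
    moreover from this m obtain n where "n \<in> M" "n \<noteq> m"
      using 3 unfolding trivial_module_def by blast
    ultimately have "(hverts H - M) \<union> {m} \<subset> hverts H"
      using m by blast
    then show ?thesis
      using realizable_if_module[OF 3(1) m] smaller MV by blast
  qed
qed

theorem theorem12:
  fixes H :: "'a hypergraph"
  assumes "hypergraph3 H"
  shows "realizable H \<longleftrightarrow>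
    (\<forall>W. W \<subseteq> hverts H \<and> hprime (induced_hypergraph H W) \<longrightarrow>
         realizable (induced_hypergraph H W))"
  using realizable_induced realizable_if_primes_realizable[OF assms] by blast

end
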